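(* Let $m\ge 2$, $n\ge1$. If the $n\times n$ complex matrix $A$ has an $m$-th root $B$ (an $n\times n$ complex matrix with $B^m=A$), then for any constant vector $x_0\in\mathbb{C}^n$ the sequence $x(t)=B^{t^1+\cdots+t^m}x_0$, $t\in\mathbb{N}^m$, is a solution of the diagonal recurrence $x(t+\mathbf{1})=Ax(t)$, $t\in\mathbb{N}^m$.
   Context: $\mathbb{N}=\{0,1,2,\dots\}$; $t=(t^1,\dots,t^m)\in\mathbb{N}^m$ (superscripts on $t$ are indices); $\mathbf{1}=(1,\dots,1)\in\mathbb{N}^m$; $B^0=I_n$. *)

theory Defs
  imports Complex_Main "Jordan_Normal_Form.Matrix"
begin

text \<open>
  A multi-index in $\mathbb{N}^m$ is an element of \<open>carrier_vec m :: nat vec set\<close>; its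
  components are numbered \<open>0, ..., m - 1\<close> instead of \<open>1, ..., m\<close>.
\<close>

definition ones_vec :: "nat \<Rightarrow> nat vec" where
  "ones_vec m = vec m (\<lambda>_. 1)"

text \<open>Only the values of \<open>x\<close> on \<open>carrier_vec m\<close> matter.\<close>

definition solves_diagonal_recurrence ::
    "nat \<Rightarrow> nat \<Rightarrow> complex mat \<Rightarrow> (nat vec \<Rightarrow> complex vec) \<Rightarrow> bool" where
  "solves_diagonal_recurrence m n A x \<longleftrightarrow>
     (\<forall>t \<in> carrier_vec m. x t \<in> carrier_vec n) \<and>
     (\<forall>t \<in> carrier_vec m. x (t + ones_vec m) = A *\<^sub>v x t)"

end

theory Submission
  imports Defs
begin

text \<open>
  Translating \<open>t\<close> by the all-ones vector raises each of its \<open>m\<close> components by one, so the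
  exponent \<open>t\<^sup>1 + \<dots> + t\<^sup>m\<close> grows by exactly \<open>m\<close>. By the law of exponents
  the power of \<open>B\<close> therefore gains a left factor \<open>B\<^sup>m = A\<close>.
\<close>

lemma pow_mat_add:
  assumes "B \<in> carrier_mat n n"
  shows "B ^\<^sub>m (k + l) = B ^\<^sub>m k * B ^\<^sub>m l"
proof (induction l)
  case 0
  show ?case
    using assms by simp
next
  case (Suc l)
  have "B ^\<^sub>m k * B ^\<^sub>m l * B = B ^\<^sub>m k * (B ^\<^sub>m l * B)"
    by (rule assoc_mult_mat[OF pow_carrier_mat[OF assms] pow_carrier_mat[OF assms] assms])
  with Suc.IH show ?case
    by simp
qed

lemma sum_components_add_ones_vec:
  assumes "t \<in> carrier_vec m"
  shows "(\<Sum>i<m. (t + ones_vec m) $ i) = m + (\<Sum>i<m. t $ i)"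
proof -
  have "(\<Sum>i<m. (t + ones_vec m) $ i) = (\<Sum>i<m. t $ i + 1)"
    by (rule sum.cong) (auto simp: ones_vec_def)
  then show ?thesis
    by (simp only: sum.distrib) simp
qed

theorem theorem3:
  fixes m n :: nat and A B :: "complex mat" and x\<^sub>0 :: "complex vec"
  assumes "m \<ge> 2" and "n \<ge> 1"
    and "A \<in> carrier_mat n n" and "B \<in> carrier_mat n n"
    and "B ^\<^sub>m m = A"
    and "x\<^sub>0 \<in> carrier_vec n"
  shows "solves_diagonal_recurrence m n A (\<lambda>t. B ^\<^sub>m (\<Sum>i<m. t $ i) *\<^sub>v x\<^sub>0)"
proof -
  have pow_carrier: "B ^\<^sub>m k \<in> carrier_mat n n" for k
    using assms(4) by (rule pow_carrier_mat)
  have "B ^\<^sub>m (\<Sum>i<m. (t + ones_vec m) $ i) *\<^sub>v x\<^sub>0 = A *\<^sub>v (B ^\<^sub>m (\<Sum>i<m. t $ i) *\<^sub>v x\<^sub>0)"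
    if "t \<in> carrier_vec m" for t
  proof -
    let ?s = "\<Sum>i<m. t $ i"
    have "B ^\<^sub>m (\<Sum>i<m. (t + ones_vec m) $ i) = B ^\<^sub>m (m + ?s)"
      using that by (simp add: sum_components_add_ones_vec)
    also have "\<dots> = A * B ^\<^sub>m ?s"
      using assms(4,5) by (simp add: pow_mat_add[OF assms(4)])
    finally show ?thesis
      using assoc_mult_mat_vec[OF assms(3) pow_carrier assms(6)] by simp
  qed
  then show ?thesis
    using pow_carrier assms(6)
    by (auto simp: solves_diagonal_recurrence_def intro: mult_mat_vec_carrier)
qed

end
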